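(* Suppose that $\bar\ell=+\infty$ and $\phi(1-\sigma)<\rho$. Then the value function $W$ is identically zero: $W(h_0)=0$ for every $h_0\ge 0$.
   Context: Parameters: $\rho>0$, $\phi>0$, $\sigma>1$, $\gamma<1$ with $\gamma(\sigma-1)>1$ (so $0<\gamma<1$), and $\underline\ell\ge 0$. Here $\bar\ell=+\infty$, so controls take values in $[\underline\ell,+\infty)$. The set of admissible controls is $\mathcal A=\{\ell\in L^1_{loc}(\mathbb R_+)\ :\ \ell(t)\in[\underline\ell,+\infty)\ \text{for } t\ge 0\}$, with $\mathbb R_+=[0,+\infty)$. For $h_0\ge 0$ and $\ell\in\mathcal A$, $h^{h_0,\ell}$ denotes the solution of $\dot h(t)=\phi(\ell(t)-h(t))$, $h(0)=h_0$, i.e. $h^{h_0,\ell}(t)=e^{-\phi t}\left[h_0+\phi\int_0^t e^{\phi s}\ell(s)\,ds\right]$. The utility is $\widetilde U(\ell,h)=\frac{(\ell/h^\gamma)^{1-\sigma}}{1-\sigma}=\frac{\ell^{1-\sigma}h^{\gamma(\sigma-1)}}{1-\sigma}$, with the convention $\widetilde U(0,h)=-\infty$. The value function is $$W(h_0)=\sup_{\ell(\cdot)\in\mathcal A}\int_0^\infty e^{-\rho t}\,\widetilde U\big(\ell(t),h^{h_0,\ell}(t)\big)\,dt ,$$ where the integral of the nonpositive integrand may equal $-\infty$. *)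

theory Defs
  imports "HOL-Analysis.Analysis"
begin

text \<open>Controls are real functions of which only the values on \<open>[0,\<infinity>)\<close> matter. Local integrability on
  \<open>[0,\<infinity>)\<close> means Lebesgue integrability on every compact subset, that is, on every \<open>[0,T]\<close>. There is no
  finite upper bound on the controls.\<close>

definition admissible :: "real \<Rightarrow> (real \<Rightarrow> real) set" where
  "admissible lmin =
     {l. (\<forall>T\<ge>0. set_integrable lebesgue {0..T} l) \<and> (\<forall>t\<ge>0. lmin \<le> l t)}"

text \<open>The solution of \<open>h' = \<phi> (l - h)\<close>, \<open>h 0 = h0\<close>, in variation-of-constants form.\<close>

definition habit :: "real \<Rightarrow> real \<Rightarrow> (real \<Rightarrow> real) \<Rightarrow> real \<Rightarrow> real" where
  "habit \<phi> h0 l t =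
     exp (- \<phi> * t) * (h0 + \<phi> * (LINT s:{0..t}|lebesgue. exp (\<phi> * s) * l s))"

text \<open>The product form of the utility is used because it makes sense also at \<open>h = 0\<close>
  (recall \<open>0 powr a = 0\<close>, and the exponent of \<open>h\<close> is positive for the parameters of interest).\<close>

definition utility :: "real \<Rightarrow> real \<Rightarrow> real \<Rightarrow> real \<Rightarrow> ereal" where
  "utility \<sigma> \<gamma> l h =
     (if l = 0 then - \<infinity>
      else ereal (l powr (1 - \<sigma>) * h powr (\<gamma> * (\<sigma> - 1)) / (1 - \<sigma>)))"

lemma utility_quotient_form:
  assumes "l > 0" "h > 0"
  shows "utility \<sigma> \<gamma> l h = ereal ((l / h powr \<gamma>) powr (1 - \<sigma>) / (1 - \<sigma>))"
proof -
  have "(l / h powr \<gamma>) powr (1 - \<sigma>) = l powr (1 - \<sigma>) / h powr (\<gamma> * (1 - \<sigma>))"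
    using assms by (simp add: powr_divide powr_powr)
  also have "\<dots> = l powr (1 - \<sigma>) * h powr (- (\<gamma> * (1 - \<sigma>)))"
    by (simp only: powr_minus divide_inverse)
  also have "- (\<gamma> * (1 - \<sigma>)) = \<gamma> * (\<sigma> - 1)"
    by (simp add: algebra_simps)
  finally show ?thesis
    using assms(1) by (simp add: utility_def)
qed

text \<open>For \<open>\<sigma> > 1\<close> the integrand is nonpositive with values in \<open>[-\<infinity>,0]\<close>, so its integral is minus the
  Lebesgue integral of the nonnegative extended-real function obtained by changing the sign.\<close>

definition payoff :: "real \<Rightarrow> real \<Rightarrow> real \<Rightarrow> real \<Rightarrow> real \<Rightarrow> (real \<Rightarrow> real) \<Rightarrow> ereal" where
  "payoff \<rho> \<phi> \<sigma> \<gamma> h0 l =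
     - enn2ereal (\<integral>\<^sup>+t\<in>{0..}.
         e2ennreal (- (ereal (exp (- \<rho> * t)) * utility \<sigma> \<gamma> (l t) (habit \<phi> h0 l t))) \<partial>lebesgue)"

definition value_fun :: "real \<Rightarrow> real \<Rightarrow> real \<Rightarrow> real \<Rightarrow> real \<Rightarrow> real \<Rightarrow> ereal" where
  "value_fun \<rho> \<phi> \<sigma> \<gamma> lmin h0 = (SUP l\<in>admissible lmin. payoff \<rho> \<phi> \<sigma> \<gamma> h0 l)"

end

theory Submission
  imports Defs
begin

text \<open>The integrand is nonpositive, so \<open>W \<le> 0\<close>; the content is that the payoff can be pushed up to \<open>0\<close>.
  Constant controls \<open>l = N\<close> with large \<open>N\<close> achieve this: the habit relaxes exponentially from \<open>h0\<close>
  towards \<open>N\<close>, so it never exceeds \<open>N\<close> once \<open>N \<ge> h0\<close>, and the utility loss per unit of time is at most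
  \<open>N powr (1 - \<sigma>) * N powr (\<gamma> * (\<sigma> - 1)) / (\<sigma> - 1)\<close>. The total exponent is \<open>(1 - \<sigma>) * (1 - \<gamma>)\<close>, which is
  negative because \<open>\<gamma> < 1\<close>: consumption outweighs the habit that it creates. Discounting divides the
  bound by \<open>\<rho>\<close>, and it tends to \<open>0\<close> as \<open>N\<close> grows (lemma \<open>payoff_const_ge\<close>).\<close>

lemma payoff_nonpos: "payoff \<rho> \<phi> \<sigma> \<gamma> h0 l \<le> 0"
  by (simp add: payoff_def)

lemma const_admissible:
  assumes "lmin \<le> N"
  shows "(\<lambda>_. N) \<in> admissible lmin"
  using assms
  by (auto simp: admissible_def intro!: absolutely_integrable_continuous_real continuous_intros)

lemma habit_const:
  assumes "\<phi> > 0" "t \<ge> 0"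
  shows "habit \<phi> h0 (\<lambda>_. N) t = N + exp (- \<phi> * t) * (h0 - N)"
proof -
  have "set_integrable lebesgue {0..t} (\<lambda>s. exp (\<phi> * s) * N)"
    by (intro absolutely_integrable_continuous_real continuous_intros)
  then have "(LINT s:{0..t}|lebesgue. exp (\<phi> * s) * N) = integral {0..t} (\<lambda>s. exp (\<phi> * s) * N)"
    by (rule set_lebesgue_integral_eq_integral)
  moreover have "((\<lambda>s. exp (\<phi> * s) * N) has_integral
      exp (\<phi> * t) * N / \<phi> - exp (\<phi> * 0) * N / \<phi>) {0..t}"
    using assms
    by (intro fundamental_theorem_of_calculus)
       (auto intro!: derivative_eq_intros simp flip: has_real_derivative_iff_has_vector_derivative)
  ultimately have "(LINT s:{0..t}|lebesgue. exp (\<phi> * s) * N) = (exp (\<phi> * t) - 1) * N / \<phi>"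
    using integral_unique
    by (metis (no_types, lifting) diff_divide_distrib exp_zero left_diff_distrib mult_zero_right)
  then show ?thesis
    using assms(1) by (simp add: habit_def exp_minus field_simps)
qed

text \<open>Under a constant control the habit is a convex combination of its initial value and its limit.\<close>

lemma habit_const_bounds:
  assumes "\<phi> > 0" "t \<ge> 0" "0 \<le> h0" "h0 \<le> N"
  shows "0 \<le> habit \<phi> h0 (\<lambda>_. N) t" "habit \<phi> h0 (\<lambda>_. N) t \<le> N"
proof -
  define e where "e = exp (- \<phi> * t)"
  have e: "0 \<le> e" "e \<le> 1"
    using assms by (auto simp: e_def)
  have eq: "habit \<phi> h0 (\<lambda>_. N) t = N + e * (h0 - N)"
    unfolding e_def by (rule habit_const[OF assms(1,2)])
  also have "\<dots> = (1 - e) * N + e * h0"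
    by (simp add: algebra_simps)
  also have "\<dots> \<ge> 0"
    using e assms by simp
  finally show "0 \<le> habit \<phi> h0 (\<lambda>_. N) t" .
  show "habit \<phi> h0 (\<lambda>_. N) t \<le> N"
    using eq e assms by (simp add: mult_nonneg_nonpos)
qed

lemma nn_integral_discounted_const:
  assumes "\<rho> > 0" "C \<ge> 0"
  shows "(\<integral>\<^sup>+t\<in>{0..}. ennreal (exp (- \<rho> * t) * C) \<partial>lebesgue) = ennreal (C / \<rho>)"
proof -
  have lim: "((\<lambda>t. - exp (- \<rho> * t) * C / \<rho>) \<longlongrightarrow> 0) at_top"
    using assms(1) by real_asymp
  have "(\<integral>\<^sup>+t. ennreal (exp (- \<rho> * t) * C) * indicator {0..} t \<partial>lborel)
      = ennreal (0 - (- exp (- \<rho> * 0) * C / \<rho>))"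
    using assms
    by (intro nn_integral_FTC_atLeast[where F="\<lambda>t. - exp (- \<rho> * t) * C / \<rho>"] lim)
       (auto intro!: derivative_eq_intros)
  then show ?thesis
    by (simp add: nn_integral_completion)
qed

lemma payoff_const_ge:
  assumes "\<rho> > 0" "\<phi> > 0" "\<sigma> > 1" "\<gamma> \<ge> 0" "0 \<le> h0" "h0 \<le> N" "N > 0"
  shows "- ereal (N powr ((1 - \<sigma>) * (1 - \<gamma>)) / (\<sigma> - 1) / \<rho>) \<le> payoff \<rho> \<phi> \<sigma> \<gamma> h0 (\<lambda>_. N)"
proof -
  define C where "C = N powr ((1 - \<sigma>) * (1 - \<gamma>)) / (\<sigma> - 1)"
  have C: "C \<ge> 0"
    using assms by (simp add: C_def)
  define L where "L t = - (ereal (exp (- \<rho> * t)) * utility \<sigma> \<gamma> N (habit \<phi> h0 (\<lambda>_. N) t))" for t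
  have loss: "e2ennreal (L t) \<le> ennreal (exp (- \<rho> * t) * C)" if "t \<ge> 0" for t
  proof -
    define h where "h = habit \<phi> h0 (\<lambda>_. N) t"
    have "N powr (1 - \<sigma>) * h powr (\<gamma> * (\<sigma> - 1)) \<le> N powr (1 - \<sigma>) * N powr (\<gamma> * (\<sigma> - 1))"
      using assms habit_const_bounds[of \<phi> t h0 N] that
      by (intro mult_left_mono powr_mono2) (auto simp: h_def)
    also have "\<dots> = N powr ((1 - \<sigma>) * (1 - \<gamma>))"
      by (simp add: algebra_simps flip: powr_add)
    finally have "N powr (1 - \<sigma>) * h powr (\<gamma> * (\<sigma> - 1)) / (\<sigma> - 1) \<le> C"
      unfolding C_def using assms by (intro divide_right_mono) auto
    then have "exp (- \<rho> * t) * (N powr (1 - \<sigma>) * h powr (\<gamma> * (\<sigma> - 1)) / (\<sigma> - 1)) \<le> exp (- \<rho> * t) * C"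
      by (rule mult_left_mono) simp
    moreover have "x / (1 - \<sigma>) = - (x / (\<sigma> - 1))" for x
      using assms(3) by (simp add: field_simps)
    ultimately show ?thesis
      using assms(7) by (simp add: L_def utility_def ennreal_leI flip: h_def)
  qed
  have "(\<integral>\<^sup>+t\<in>{0..}. e2ennreal (L t) \<partial>lebesgue)
      \<le> (\<integral>\<^sup>+t\<in>{0..}. ennreal (exp (- \<rho> * t) * C) \<partial>lebesgue)"
    using loss by (intro nn_integral_mono) (auto split: split_indicator)
  also have "\<dots> = ennreal (C / \<rho>)"
    by (rule nn_integral_discounted_const[OF assms(1) C])
  finally have "enn2ereal (\<integral>\<^sup>+t\<in>{0..}. e2ennreal (L t) \<partial>lebesgue) \<le> enn2ereal (ennreal (C / \<rho>))"
    by (simp add: less_eq_ennreal.rep_eq)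
  also have "\<dots> = ereal (C / \<rho>)"
    using C assms(1) by (simp add: enn2ereal_ennreal)
  finally show ?thesis
    unfolding payoff_def C_def L_def by (simp only: ereal_minus_le_minus)
qed

theorem proposition1:
  fixes \<rho> \<phi> \<sigma> \<gamma> lmin :: real
  assumes "\<rho> > 0" and "\<phi> > 0" and "\<sigma> > 1" and "\<gamma> < 1" and "\<gamma> * (\<sigma> - 1) > 1"
    and "lmin \<ge> 0"
    and "\<phi> * (1 - \<sigma>) < \<rho>"
  shows "\<forall>h0\<ge>0. value_fun \<rho> \<phi> \<sigma> \<gamma> lmin h0 = 0"
proof (intro allI impI antisym)
  fix h0 :: real
  assume h0: "h0 \<ge> 0"
  show "value_fun \<rho> \<phi> \<sigma> \<gamma> lmin h0 \<le> 0"
    unfolding value_fun_def by (intro SUP_least payoff_nonpos)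
  have "0 < \<gamma> * (\<sigma> - 1)"
    using assms(5) by linarith
  then have \<gamma>: "\<gamma> \<ge> 0"
    using assms(3) by (simp add: zero_less_mult_iff)
  let ?bound = "\<lambda>N. N powr ((1 - \<sigma>) * (1 - \<gamma>)) / (\<sigma> - 1) / \<rho>"
  have "(1 - \<sigma>) * (1 - \<gamma>) < 0"
    using assms(3,4) by (simp add: mult_neg_pos)
  then have "((\<lambda>N. N powr ((1 - \<sigma>) * (1 - \<gamma>))) \<longlongrightarrow> 0) at_top"
    by (intro tendsto_neg_powr filterlim_ident)
  then have "((\<lambda>N. - ?bound N) \<longlongrightarrow> - (0 / (\<sigma> - 1) / \<rho>)) at_top"
    using assms(1,3) by (intro tendsto_intros) auto
  then have "((\<lambda>N. - ereal (?bound N)) \<longlongrightarrow> 0) at_top"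
    by (simp add: zero_ereal_def)
  moreover have "\<forall>\<^sub>F N in at_top. - ereal (?bound N) \<le> value_fun \<rho> \<phi> \<sigma> \<gamma> lmin h0"
    using eventually_gt_at_top[of 0] eventually_ge_at_top[of h0] eventually_ge_at_top[of lmin]
  proof eventually_elim
    case (elim N)
    have "- ereal (?bound N) \<le> payoff \<rho> \<phi> \<sigma> \<gamma> h0 (\<lambda>_. N)"
      using assms(1-3) \<gamma> h0 elim by (intro payoff_const_ge) auto
    also have "\<dots> \<le> value_fun \<rho> \<phi> \<sigma> \<gamma> lmin h0"
      unfolding value_fun_def using elim by (intro SUP_upper const_admissible) auto
    finally show ?case .
  qed
  ultimately show "0 \<le> value_fun \<rho> \<phi> \<sigma> \<gamma> lmin h0"
    by (intro tendsto_upperbound) auto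
qed

end
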